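(* Let $n\in\mathbb{N}^*$, let $\Omega\subset\mathbb{R}^n$ be open and let $f\in C^2(\Omega)$ be real-valued. Let $\Omega_0\subset\Omega$ and $\Omega_0^*\subset\mathbb{R}^n$ be non-empty open sets such that the gradient map $f'$ restricts to a ($C^1$) diffeomorphism from $\Omega_0$ onto $\Omega_0^*$, and suppose that the Hessian matrix $M_f(a)=\left[\frac{\partial^2 f}{\partial x_j\partial x_l}(a)\right]_{1\le j,l\le n}$ is invertible for every $a\in\Omega_0$. Let $f^*:\Omega_0^*\to\mathbb{R}$ be the Legendre transform of $f$ on $\Omega_0^*$. Then one can associate to $f$ Clifford algebras $C(\mathbb{R}^n,q_f(\cdot,a))$ for each $a\in\Omega_0$ and $C(\mathbb{R}^n,q_{f^*}(\cdot,a^* ))$ for each $a^*\in\Omega_0^*$; that is, for each $a \in \Omega_0$ (respectively each $a^*\in\Omega_0^*$) a Clifford algebra of the quadratic space $(\mathbb{R}^n,q_f(\cdot,a))$ (respectively $(\mathbb{R}^n,q_{f^*}(\cdot,a^* ))$) exists.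
   Context: Here $\mathbb{N}^*=\{1,2,\dots\}$. With $g=(f'|_{\Omega_0})^{-1}:\Omega_0^*\to\Omega_0$, the Legendre transform is, in this paper's sign convention, $f^*(x^* )=f(g(x^* ))-\langle g(x^* )\mid x^*\rangle$ for $x^*\in\Omega_0^*$, where $\langle\cdot\mid\cdot\rangle$ is the Euclidean scalar product. For a $C^2$ function $h$ on an open subset of $\mathbb{R}^n$ and a point $a$ of that set, $q_h(\cdot,a)$ is the quadratic form $v\mapsto \sum_{j,l=1}^n\frac{\partial^2 h}{\partial x_j\partial x_l}(a)\,v_jv_l$ on $\mathbb{R}^n$. For a quadratic space $(E,q)$ of finite dimension $n$ over $\mathbb{R}$, a Clifford algebra $C(E,q)$ is a unital associative $\mathbb{R}$-algebra $\mathbf{A}$ together with a linear map $\varphi:E\to\mathbf{A}$ such that $\varphi(x)^2=q(x)\,\mathbf{1}_{\mathbf{A}}$ for all $x\in E$, and such that for every basis $(e_1,\dots,e_n)$ of $E$ that is orthogonal for the symmetric bilinear form associated to $q$, and normalized so that this form takes the value $\pm1$ on each pair $(e_j,e_j)$, the products $\varphi(e_{j_1})\cdots\varphi(e_{j_k})$, $1\le j_1<\dots<j_k\le n$, $0\le k\le n$ (the empty product being $\mathbf{1}_{\mathbf{A}}$), form a basis of $\mathbf{A}$; in particular $\dim C(E,q)=2^n$. *)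

theory Defs
  imports "HOL-Analysis.Analysis"
begin

definition C1_on :: "'a::real_normed_vector set \<Rightarrow> ('a \<Rightarrow> 'b::real_normed_vector) \<Rightarrow> bool" where
  "C1_on S F \<longleftrightarrow>
     (\<exists>F'. (\<forall>x\<in>S. (F has_derivative blinfun_apply (F' x)) (at x)) \<and> continuous_on S F')"

definition C1_diffeomorphism ::
  "'a::real_normed_vector set \<Rightarrow> 'b::real_normed_vector set \<Rightarrow> ('a \<Rightarrow> 'b) \<Rightarrow> bool" where
  "C1_diffeomorphism S T F \<longleftrightarrow>
     bij_betw F S T \<and> C1_on S F \<and> C1_on T (the_inv_into S F)"

definition partial_deriv :: "'n::finite \<Rightarrow> (real ^ 'n \<Rightarrow> real) \<Rightarrow> real ^ 'n \<Rightarrow> real" where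
  "partial_deriv j h x = deriv (\<lambda>t. h (x + t *\<^sub>R axis j 1)) 0"

definition C2_on :: "(real ^ 'n::finite) set \<Rightarrow> (real ^ 'n \<Rightarrow> real) \<Rightarrow> bool" where
  "C2_on S h \<longleftrightarrow> C1_on S h \<and> (\<forall>j. C1_on S (partial_deriv j h))"

definition grad :: "(real ^ 'n::finite \<Rightarrow> real) \<Rightarrow> real ^ 'n \<Rightarrow> real ^ 'n" where
  "grad h x = (\<chi> j. partial_deriv j h x)"

definition hessian :: "(real ^ 'n::finite \<Rightarrow> real) \<Rightarrow> real ^ 'n \<Rightarrow> real ^ 'n ^ 'n" where
  "hessian h a = (\<chi> j l. partial_deriv j (partial_deriv l h) a)"

definition hessian_form :: "(real ^ 'n::finite \<Rightarrow> real) \<Rightarrow> real ^ 'n \<Rightarrow> real ^ 'n \<Rightarrow> real" where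
  "hessian_form h a v = (\<Sum>j\<in>UNIV. \<Sum>l\<in>UNIV. hessian h a $ j $ l * v $ j * v $ l)"

text \<open>The sign is opposite to the usual one. Only the values at points of the image of \<open>S\<close>
  under \<open>grad f\<close> are meaningful.\<close>

definition legendre ::
  "(real ^ 'n::finite) set \<Rightarrow> (real ^ 'n \<Rightarrow> real) \<Rightarrow> real ^ 'n \<Rightarrow> real" where
  "legendre S f y = (let g = the_inv_into S (grad f) in f (g y) - g y \<bullet> y)"

definition polar_form :: "('e::real_vector \<Rightarrow> real) \<Rightarrow> 'e \<Rightarrow> 'e \<Rightarrow> real" where
  "polar_form q x y = (q (x + y) - q x - q y) / 2"

definition family_basis :: "'i set \<Rightarrow> ('i \<Rightarrow> 'v::real_vector) \<Rightarrow> bool" where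
  "family_basis I b \<longleftrightarrow> inj_on b I \<and> independent (b ` I) \<and> span (b ` I) = UNIV"

definition normalized_basis :: "('e::euclidean_space \<Rightarrow> real) \<Rightarrow> (nat \<Rightarrow> 'e) \<Rightarrow> bool" where
  "normalized_basis q e \<longleftrightarrow>
     family_basis {1..DIM('e)} e \<and>
     (\<forall>i\<in>{1..DIM('e)}. \<forall>j\<in>{1..DIM('e)}. i \<noteq> j \<longrightarrow> polar_form q (e i) (e j) = 0) \<and>
     (\<forall>j\<in>{1..DIM('e)}. polar_form q (e j) (e j) \<in> {1, -1})"

definition ordered_prod :: "('b \<Rightarrow> 'b \<Rightarrow> 'b) \<Rightarrow> 'b \<Rightarrow> (nat \<Rightarrow> 'b) \<Rightarrow> nat set \<Rightarrow> 'b" where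
  "ordered_prod mul u x J = foldr mul (map x (sorted_list_of_set J)) u"

text \<open>The algebra is a real vector space with an explicit multiplication and unit, not an instance
  of \<open>real_algebra_1\<close>, so that the existence of an algebra structure can be stated inside a formula.\<close>

definition unital_algebra :: "('b::real_vector \<Rightarrow> 'b \<Rightarrow> 'b) \<Rightarrow> 'b \<Rightarrow> bool" where
  "unital_algebra mul u \<longleftrightarrow>
     bilinear mul \<and>
     (\<forall>x y z. mul (mul x y) z = mul x (mul y z)) \<and>
     (\<forall>x. mul u x = x \<and> mul x u = x)"

text \<open>A normalized basis is required to exist (equivalently, \<open>q\<close> is nondegenerate): otherwise the
  last condition would be vacuous, and the dimension of the algebra would not be forced to be
  \<open>2 ^ DIM('e)\<close>.\<close>

definition clifford_algebra ::
  "('e::euclidean_space \<Rightarrow> real) \<Rightarrow> ('b::real_vector \<Rightarrow> 'b \<Rightarrow> 'b) \<Rightarrow> 'b \<Rightarrow> ('e \<Rightarrow> 'b) \<Rightarrow> bool" where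
  "clifford_algebra q mul u \<phi> \<longleftrightarrow>
     unital_algebra mul u \<and>
     linear \<phi> \<and>
     (\<forall>x. mul (\<phi> x) (\<phi> x) = q x *\<^sub>R u) \<and>
     (\<exists>e. normalized_basis q e) \<and>
     (\<forall>e. normalized_basis q e \<longrightarrow>
        family_basis (Pow {1..DIM('e)}) (ordered_prod mul u (\<phi> \<circ> e)))"

text \<open>A Clifford algebra of a quadratic form on \<open>real ^ 'n\<close> has dimension \<open>2 ^ CARD('n)\<close>, so up to a
  linear isomorphism its underlying vector space is \<open>real ^ ('n set)\<close>, and fixing this space loses no
  generality.\<close>

definition has_clifford_algebra :: "(real ^ 'n::finite \<Rightarrow> real) \<Rightarrow> bool" where
  "has_clifford_algebra q \<longleftrightarrow>
     (\<exists>(mul :: real ^ ('n set) \<Rightarrow> real ^ ('n set) \<Rightarrow> real ^ ('n set)) u \<phi>. clifford_algebra q mul u \<phi>)"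

end

theory Submission
  imports Defs
begin

text \<open>The gradient of the Legendre transform is \<open>- g\<close>, where \<open>g\<close> is the inverse of \<open>grad f\<close>; hence it is
  \<open>C\<^sup>2\<close> and its Hessian is, up to sign and transposition, the derivative of \<open>g\<close>, which is invertible. As Hessians of
  \<open>C\<^sup>2\<close> functions are symmetric, both Hessian forms are nondegenerate quadratic forms and have
  orthogonal bases normalized to \<open>\<plusminus>1\<close>. For such a basis the Clifford algebra is a twisted group algebra
  of \<open>(Z/2)\<^sup>n\<close> whose cocycle is bimultiplicative, which makes associativity immediate. For any other
  normalized basis, the span of the ordered products is stable under left multiplication by vectors,
  so it is the whole algebra, and counting dimensions shows that the products are independent.\<close>

section \<open>Symmetry of the Hessian\<close>

lemma has_derivative_imp_partial:
  assumes "(h has_derivative D) (at (y + s *\<^sub>R axis i 1))"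
  shows "((\<lambda>t. h (y + t *\<^sub>R axis i 1)) has_real_derivative D (axis i 1)) (at s)"
proof -
  have "((\<lambda>t. h (y + t *\<^sub>R axis i 1)) has_derivative (\<lambda>t. D (t *\<^sub>R axis i 1))) (at s)"
    by (rule has_derivative_compose[where g = h and f = "\<lambda>t. y + t *\<^sub>R axis i 1"])
      (auto intro!: derivative_eq_intros assms)
  moreover have "(\<lambda>t. D (t *\<^sub>R axis i 1)) = (*) (D (axis i 1))"
    using has_derivative_linear[OF assms] by (auto simp: linear_cmul)
  ultimately show ?thesis
    by (simp add: has_field_derivative_def)
qed

lemma partial_deriv_eq:
  assumes "(h has_derivative D) (at x)"
  shows "partial_deriv i h x = D (axis i 1)"
  unfolding partial_deriv_def
  using has_derivative_imp_partial[of h D x 0 i] assms by (simp add: DERIV_imp_deriv)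

lemma has_derivative_grad:
  fixes h :: "real ^ 'n::finite \<Rightarrow> real"
  assumes "(h has_derivative D) (at x)"
  shows "D v = grad h x \<bullet> v"
proof -
  have "linear D"
    using assms has_derivative_linear by blast
  have "D v = D (\<Sum>i\<in>UNIV. v $ i *\<^sub>R axis i 1)"
    by (simp add: basis_expansion flip: scalar_mult_eq_scaleR)
  also have "\<dots> = (\<Sum>i\<in>UNIV. v $ i * D (axis i 1))"
    using \<open>linear D\<close> by (simp add: linear_sum linear_cmul)
  finally show ?thesis
    by (simp add: inner_vec_def grad_def partial_deriv_eq[OF assms] mult.commute)
qed

text \<open>\<open>partial_deriv\<close> only looks at parameter 0 of a line; the mean value theorem
  needs the derivative at every parameter \<open>s\<close> of a fixed line.\<close>

lemma C1_on_partial_DERIV: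
  assumes "C1_on S h" "y + s *\<^sub>R axis i 1 \<in> S"
  shows "((\<lambda>t. h (y + t *\<^sub>R axis i 1)) has_real_derivative
    partial_deriv i h (y + s *\<^sub>R axis i 1)) (at s)"
proof -
  obtain D where "(h has_derivative D) (at (y + s *\<^sub>R axis i 1))"
    using assms unfolding C1_on_def by blast
  then show ?thesis
    using has_derivative_imp_partial[of h D y s i] by (simp add: partial_deriv_eq)
qed

lemma C1_on_continuous_partial:
  assumes "C1_on S h"
  shows "continuous_on S (partial_deriv i h)"
proof -
  obtain F where "\<forall>x\<in>S. (h has_derivative blinfun_apply (F x)) (at x)" and F: "continuous_on S F"
    using assms C1_on_def by blast
  then have "\<And>x. x \<in> S \<Longrightarrow> partial_deriv i h x = blinfun_apply (F x) (axis i 1)"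
    using partial_deriv_eq by blast
  moreover have "continuous_on S (\<lambda>x. blinfun_apply (F x) (axis i 1))"
    by (intro continuous_intros F)
  ultimately show ?thesis
    using continuous_on_cong by force
qed

text \<open>The mean value theorem is applied twice to a second difference, first along axis
  \<open>i\<close>, then along axis \<open>j\<close>. The left-hand side is symmetric in
  \<open>i\<close> and \<open>j\<close>, which is what makes the two orders of differentiation
  comparable.\<close>

lemma mixed_difference_eq_partial:
  assumes h: "C1_on S h" "C1_on S (partial_deriv i h)" and "t > 0" and S: "cball a (2 * t) \<subseteq> S"
  shows "\<exists>x\<in>cball a (2 * t). h (a + t *\<^sub>R axis i 1 + t *\<^sub>R axis j 1) - h (a + t *\<^sub>R axis i 1)
    - h (a + t *\<^sub>R axis j 1) + h a = t * (t * partial_deriv j (partial_deriv i h) x)"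
proof -
  \<comment> \<open>The bound \<open>s + r \<le> 2 * t\<close> explains the radius of the
    ball.\<close>
  have near: "a + s *\<^sub>R axis i 1 + r *\<^sub>R axis j 1 \<in> cball a (2 * t)"
    if "0 \<le> s" "s \<le> t" "0 \<le> r" "r \<le> t" for s r
  proof -
    have "norm (s *\<^sub>R axis i 1 + r *\<^sub>R axis j 1 :: real ^ 'a) \<le> \<bar>s\<bar> + \<bar>r\<bar>"
      by (rule order_trans[OF norm_triangle_ineq]) simp
    moreover have "dist a (a + s *\<^sub>R axis i 1 + r *\<^sub>R axis j 1)
        = norm (s *\<^sub>R axis i 1 + r *\<^sub>R axis j 1 :: real ^ 'a)"
      by (simp add: dist_norm norm_minus_commute add_ac)
    ultimately show ?thesis
      using that by (simp del: dist_add_cancel)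
  qed
  let ?p = "partial_deriv i h"
  \<comment> \<open>First application: the function is the difference of \<open>h\<close> between
    two parallel sides, depending on the position \<open>s\<close> along them.\<close>
  have "\<exists>s. 0 < s \<and> s < t \<and>
      (h (a + t *\<^sub>R axis j 1 + t *\<^sub>R axis i 1) - h (a + t *\<^sub>R axis i 1))
      - (h (a + t *\<^sub>R axis j 1 + 0 *\<^sub>R axis i 1) - h (a + 0 *\<^sub>R axis i 1))
      = (t - 0) * (?p (a + t *\<^sub>R axis j 1 + s *\<^sub>R axis i 1) - ?p (a + s *\<^sub>R axis i 1))"
  proof (rule MVT2[OF \<open>t > 0\<close>])
    fix s assume s: "0 \<le> s" "s \<le> t"
    have 1: "a + t *\<^sub>R axis j 1 + s *\<^sub>R axis i 1 \<in> S"
      using near[of s t] s S by (auto simp: add_ac)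
    have 2: "a + s *\<^sub>R axis i 1 \<in> S"
      using near[of s 0] s S by auto
    show "((\<lambda>s. h (a + t *\<^sub>R axis j 1 + s *\<^sub>R axis i 1) - h (a + s *\<^sub>R axis i 1))
      has_real_derivative ?p (a + t *\<^sub>R axis j 1 + s *\<^sub>R axis i 1) - ?p (a + s *\<^sub>R axis i 1)) (at s)"
      by (intro derivative_intros C1_on_partial_DERIV[OF h(1)] 1 2)
  qed
  then obtain s where s: "0 < s" "s < t" and 1:
    "h (a + t *\<^sub>R axis i 1 + t *\<^sub>R axis j 1) - h (a + t *\<^sub>R axis i 1) - h (a + t *\<^sub>R axis j 1) + h a
      = t * (?p (a + s *\<^sub>R axis i 1 + t *\<^sub>R axis j 1) - ?p (a + s *\<^sub>R axis i 1))"
    by (auto simp: algebra_simps)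
  have "\<exists>r. 0 < r \<and> r < t \<and>
      ?p (a + s *\<^sub>R axis i 1 + t *\<^sub>R axis j 1) - ?p (a + s *\<^sub>R axis i 1 + 0 *\<^sub>R axis j 1)
      = (t - 0) * partial_deriv j ?p (a + s *\<^sub>R axis i 1 + r *\<^sub>R axis j 1)"
  proof (rule MVT2[OF \<open>t > 0\<close>])
    fix r assume "0 \<le> r" "r \<le> t"
    then show "((\<lambda>r. ?p (a + s *\<^sub>R axis i 1 + r *\<^sub>R axis j 1)) has_real_derivative
        partial_deriv j ?p (a + s *\<^sub>R axis i 1 + r *\<^sub>R axis j 1)) (at r)"
      using near[of s r] s S by (intro C1_on_partial_DERIV[OF h(2)]) auto
  qed
  then obtain r where "0 < r" "r < t" and 2:
    "?p (a + s *\<^sub>R axis i 1 + t *\<^sub>R axis j 1) - ?p (a + s *\<^sub>R axis i 1)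
      = t * partial_deriv j ?p (a + s *\<^sub>R axis i 1 + r *\<^sub>R axis j 1)"
    by auto
  show ?thesis
    using near[of s r] s \<open>0 < r\<close> \<open>r < t\<close> 1 2 by (intro bexI) auto
qed

text \<open>Schwarz's theorem: the same second difference, divided by \<open>t * t\<close>, is a
  value of either mixed partial at a point close to \<open>a\<close>, and both mixed partials are
  continuous.\<close>

lemma partial_derivs_commute:
  assumes h: "C2_on S h" and "open S" "a \<in> S"
  shows "partial_deriv j (partial_deriv i h) a = partial_deriv i (partial_deriv j h) a"
proof (rule ccontr)
  let ?H = "\<lambda>i j. partial_deriv j (partial_deriv i h)"
  assume neq: "?H i j a \<noteq> ?H j i a"
  \<comment> \<open>Half the supposed gap: two numbers within \<open>e\<close> of a common value
    cannot be \<open>2 * e\<close> apart.\<close>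
  define e where "e = dist (?H i j a) (?H j i a) / 2"
  have "e > 0"
    using neq by (simp add: e_def)
  have C1: "C1_on S h" "\<And>i. C1_on S (partial_deriv i h)"
    using h by (auto simp: C2_on_def)
  have close: "\<exists>d>0. \<forall>x. dist x a < d \<longrightarrow> dist (?H i j x) (?H i j a) < e" for i j
  proof -
    have "isCont (?H i j) a"
      using C1_on_continuous_partial[OF C1(2)] assms continuous_on_eq_continuous_at by blast
    then show ?thesis
      using \<open>e > 0\<close> unfolding continuous_at_eps_delta by blast
  qed
  obtain d1 where d1: "d1 > 0" "\<And>x. dist x a < d1 \<Longrightarrow> dist (?H i j x) (?H i j a) < e"
    using close by metis
  obtain d2 where d2: "d2 > 0" "\<And>x. dist x a < d2 \<Longrightarrow> dist (?H j i x) (?H j i a) < e"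
    using close by metis
  obtain d3 where d3: "d3 > 0" "cball a d3 \<subseteq> S"
    using assms open_contains_cball by blast
  \<comment> \<open>Dividing by 4 rather than 2 makes \<open>2 * t\<close> strictly smaller than
    \<open>d1\<close> and \<open>d2\<close>.\<close>
  define t where "t = min d3 (min d1 d2) / 4"
  have t: "t > 0" "2 * t < d1" "2 * t < d2" "cball a (2 * t) \<subseteq> S"
    using d1 d2 d3 by (auto simp: t_def)
  obtain x where x: "x \<in> cball a (2 * t)"
    "h (a + t *\<^sub>R axis i 1 + t *\<^sub>R axis j 1) - h (a + t *\<^sub>R axis i 1)
    - h (a + t *\<^sub>R axis j 1) + h a = t * (t * ?H i j x)"
    using mixed_difference_eq_partial[OF C1 t(1,4)] by blast
  obtain y where y: "y \<in> cball a (2 * t)"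
    "h (a + t *\<^sub>R axis j 1 + t *\<^sub>R axis i 1) - h (a + t *\<^sub>R axis j 1)
    - h (a + t *\<^sub>R axis i 1) + h a = t * (t * ?H j i y)"
    using mixed_difference_eq_partial[OF C1 t(1,4)] by blast
  have "t * (t * ?H i j x) = t * (t * ?H j i y)"
    using x(2) y(2) by (simp add: algebra_simps)
  then have "?H i j x = ?H j i y"
    using t(1) by simp
  moreover have "dist (?H i j x) (?H i j a) < e" "dist (?H j i y) (?H j i a) < e"
    using d1(2)[of x] d2(2)[of y] x(1) y(1) t by (auto simp: dist_commute)
  ultimately have "dist (?H i j a) (?H j i a) < 2 * e"
    by (smt (verit) dist_triangle2 dist_commute)
  then show False
    by (simp add: e_def)
qed

lemma transpose_hessian:
  assumes "C2_on S h" "open S" "a \<in> S"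
  shows "transpose (hessian h a) = hessian h a"
  unfolding transpose_def hessian_def
  using partial_derivs_commute[OF assms] by (auto simp: vec_eq_iff)

text \<open>The existence theorem for Clifford algebras is proved for the diagonal of a symmetric
  bilinear form. The diagonal here is \<open>hessian_form\<close>; symmetry amounts to commuting
  mixed partials.\<close>

definition hessian_bilinear :: "(real ^ 'n::finite \<Rightarrow> real) \<Rightarrow> real ^ 'n \<Rightarrow> real ^ 'n \<Rightarrow> real ^ 'n \<Rightarrow> real"
  where "hessian_bilinear h a v w = v \<bullet> (hessian h a *v w)"

lemma hessian_bilinear_diag: "hessian_bilinear h a v v = hessian_form h a v"
  by (simp add: hessian_bilinear_def hessian_form_def inner_vec_def matrix_vector_mult_def
      sum_distrib_left mult_ac)

lemma bilinear_hessian_bilinear: "bilinear (hessian_bilinear h a)"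
  unfolding bilinear_def hessian_bilinear_def
  by (auto intro!: linearI simp: inner_simps matrix_vector_right_distrib matrix_vector_mult_scaleR)

lemma hessian_bilinear_commute:
  assumes "C2_on S h" "open S" "a \<in> S"
  shows "hessian_bilinear h a v w = hessian_bilinear h a w v"
  using transpose_hessian[OF assms]
  by (metis dot_lmul_matrix hessian_bilinear_def inner_commute transpose_matrix_vector)

section \<open>Calculus of \<open>C1_on\<close>\<close>

lemma C1_on_subset: "C1_on S F \<Longrightarrow> T \<subseteq> S \<Longrightarrow> C1_on T F"
  unfolding C1_on_def by (meson continuous_on_subset subsetD)

lemma C1_on_continuous:
  assumes "C1_on S F"
  shows "continuous_on S F"
proof (rule continuous_at_imp_continuous_on, rule ballI)
  obtain F' where "\<forall>x\<in>S. (F has_derivative blinfun_apply (F' x)) (at x)"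
    using assms C1_on_def by blast
  then show "isCont F x" if "x \<in> S" for x
    using that has_derivative_continuous by blast
qed

text \<open>\<open>C1_on\<close> takes derivatives in the whole space; since \<open>S\<close> is
  open, equality on \<open>S\<close> is equality near each of its points.\<close>

lemma C1_on_cong:
  assumes "C1_on S F" "open S" "\<And>x. x \<in> S \<Longrightarrow> F x = G x"
  shows "C1_on S G"
  using assms has_derivative_transform_within_open unfolding C1_on_def by metis

lemma bounded_linear_C1_on:
  assumes "C1_on S F" "bounded_linear L"
  shows "C1_on S (\<lambda>x. L (F x))"
proof -
  obtain F' where F': "\<forall>x\<in>S. (F has_derivative blinfun_apply (F' x)) (at x)" "continuous_on S F'"
    using assms C1_on_def by blast
  show ?thesis
    unfolding C1_on_def
  proof (intro exI conjI ballI)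
    fix x assume "x \<in> S"
    have "blinfun_apply (Blinfun L o\<^sub>L F' x) = (\<lambda>v. L (blinfun_apply (F' x) v))"
      by (simp add: fun_eq_iff bounded_linear_Blinfun_apply[OF assms(2)])
    then show "((\<lambda>x. L (F x)) has_derivative blinfun_apply (Blinfun L o\<^sub>L F' x)) (at x)"
      using bounded_linear.has_derivative[OF assms(2)] F'(1) \<open>x \<in> S\<close> by metis
  next
    show "continuous_on S (\<lambda>x. Blinfun L o\<^sub>L F' x)"
      by (intro continuous_intros F')
  qed
qed

section \<open>Normalized orthogonal bases\<close>

text \<open>Polarization: if the diagonal vanished on \<open>S\<close>, expanding
  \<open>B (x + y) (x + y)\<close> would leave \<open>2 * B x y = 0\<close>.\<close>

lemma bilinear_diag_nonzero:
  fixes B :: "'e::euclidean_space \<Rightarrow> 'e \<Rightarrow> real"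
  assumes B: "bilinear B" "\<And>x y. B x y = B y x" and S: "subspace S"
    and "x \<in> S" "y \<in> S" "B x y \<noteq> 0"
  shows "\<exists>z\<in>S. B z z \<noteq> 0"
proof (rule ccontr)
  assume neg: "\<not> ?thesis"
  have "B (x + y) (x + y) = B x x + B y y + 2 * B x y"
    by (simp add: bilinear_ladd[OF B(1)] bilinear_radd[OF B(1)] B(2)[of y x])
  then show False
    using neg assms subspace_add[OF S, of x y] by auto
qed

text \<open>Gram-Schmidt for a possibly indefinite form: split off a non-isotropic vector and pass
  to its orthogonal complement in \<open>S\<close>, which is again nondegenerate. The formulation
  for subspaces allows induction on the dimension.\<close>

lemma orthonormal_basis_exists:
  fixes B :: "'e::euclidean_space \<Rightarrow> 'e \<Rightarrow> real"
  assumes B: "bilinear B" "\<And>x y. B x y = B y x"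
  assumes "subspace S" "\<And>x. x \<in> S \<Longrightarrow> (\<forall>y\<in>S. B x y = 0) \<Longrightarrow> x = 0"
  shows "\<exists>T. independent T \<and> span T = S \<and> (\<forall>x\<in>T. \<forall>y\<in>T. x \<noteq> y \<longrightarrow> B x y = 0) \<and>
    (\<forall>x\<in>T. B x x \<in> {1, -1})"
  using assms(3,4)
proof (induction "dim S" arbitrary: S rule: less_induct)
  case less
  note lin = bilinear_ladd[OF B(1)] bilinear_radd[OF B(1)] bilinear_lmul[OF B(1)]
    bilinear_rmul[OF B(1)] bilinear_lsub[OF B(1)] bilinear_rsub[OF B(1)] bilinear_lzero[OF B(1)]
    bilinear_rzero[OF B(1)]
  show ?case
  proof (cases "S \<subseteq> {0}")
    case True
    then have "S = {0}"
      using less.prems(1) subspace_0 by blast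
    then show ?thesis
      by (intro exI[of _ "{}"]) (auto simp: independent_empty)
  next
    case False
    then obtain z0 where z0: "z0 \<in> S" "B z0 z0 \<noteq> 0"
      using less.prems bilinear_diag_nonzero[OF B less.prems(1)] by blast
    \<comment> \<open>\<open>B z0 z0\<close> may be negative; after this scaling only its sign is
      left.\<close>
    define z where "z = (1 / sqrt \<bar>B z0 z0\<bar>) *\<^sub>R z0"
    have z: "z \<in> S" "B z z \<in> {1, -1}"
      using z0 less.prems(1) by (auto simp: z_def lin subspace_mul abs_if field_simps)
    then have zz: "B z z \<noteq> 0" "B z z * B z z = 1"
      by auto
    define S' where "S' = {y \<in> S. B z y = 0}"
    have S': "subspace S'"
      using less.prems(1) by (auto simp: S'_def subspace_def lin)
    \<comment> \<open>Subtraction of the projection onto \<open>z\<close>. As \<open>B z z\<close>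
      is its own inverse, multiplying by it replaces division.\<close>
    have split: "y - (B z y * B z z) *\<^sub>R z \<in> S'" if "y \<in> S" for y
      using that z zz less.prems(1) by (auto simp: S'_def lin subspace_diff subspace_mul)
    have "z \<notin> S'"
      using zz by (simp add: S'_def)
    then have "S' \<subset> S"
      using z by (auto simp: S'_def)
    then have "dim S' < dim S"
      using S' less.prems(1) by (metis dim_psubset span_eq_iff)
    \<comment> \<open>By \<open>split\<close>, a vector orthogonal to \<open>S'\<close> and to
      \<open>z\<close> is orthogonal to all of \<open>S\<close>.\<close>
    moreover have "x = 0" if x: "x \<in> S'" "\<forall>y\<in>S'. B x y = 0" for x
    proof (rule less.prems(2))
      show "\<forall>y\<in>S. B x y = 0"
      proof
        fix y assume "y \<in> S"
        then have "B x (y - (B z y * B z z) *\<^sub>R z) = 0"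
          using x split by blast
        moreover have "B x z = 0"
          using x B(2)[of x z] by (simp add: S'_def)
        ultimately show "B x y = 0"
          by (simp add: lin)
      qed
    qed (use x in \<open>simp add: S'_def\<close>)
    ultimately obtain T where T: "independent T" "span T = S'"
      "\<And>x y. x \<in> T \<Longrightarrow> y \<in> T \<Longrightarrow> x \<noteq> y \<Longrightarrow> B x y = 0" "\<And>x. x \<in> T \<Longrightarrow> B x x \<in> {1, -1}"
      using less.hyps[OF _ S'] by metis
    have zT: "B z x = 0" "B x z = 0" if "x \<in> T" for x
      using that span_base[of x T] T(2) B(2)[of x z] by (auto simp: S'_def)
    show ?thesis
    proof (intro exI[of _ "insert z T"] conjI ballI impI)
      show "independent (insert z T)"
        using T \<open>z \<notin> S'\<close> independent_insert by metis
      show "span (insert z T) = S"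
      proof
        have "T \<subseteq> S"
          using T(2) span_superset \<open>S' \<subset> S\<close> by blast
        then show "span (insert z T) \<subseteq> S"
          using z less.prems(1) by (simp add: span_minimal)
        show "S \<subseteq> span (insert z T)"
          using split T(2) span_breakdown_eq[of _ z T] by (metis subsetI)
      qed
      show "B x y = 0" if "x \<in> insert z T" "y \<in> insert z T" "x \<noteq> y" for x y
        using that zT T(3) by (cases "x = z"; cases "y = z"; simp)
      show "B x x \<in> {1, -1}" if "x \<in> insert z T" for x
        using that z(2) T(4) by (cases "x = z"; simp)
    qed
  qed
qed

lemma polar_form_bilinear:
  assumes "bilinear B" "\<And>x y. B x y = B y x"
  shows "polar_form (\<lambda>x. B x x) x y = B x y"
  using assms(2)[of y x] by (simp add: polar_form_def bilinear_ladd[OF assms(1)] bilinear_radd[OF assms(1)])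

lemma normalized_basis_exists:
  fixes B :: "'e::euclidean_space \<Rightarrow> 'e \<Rightarrow> real"
  assumes B: "bilinear B" "\<And>x y. B x y = B y x"
    and nondeg: "\<And>x. (\<And>y. B x y = 0) \<Longrightarrow> x = 0"
  shows "\<exists>e. normalized_basis (\<lambda>x. B x x) e"
proof -
  obtain T where T: "independent T" "span T = UNIV"
    "\<And>x y. x \<in> T \<Longrightarrow> y \<in> T \<Longrightarrow> x \<noteq> y \<Longrightarrow> B x y = 0" "\<And>x. x \<in> T \<Longrightarrow> B x x \<in> {1, -1}"
    using orthonormal_basis_exists[OF B subspace_UNIV] nondeg by (metis UNIV_I)
  have "finite T" "card T = DIM('e)"
    using T(1,2) independent_imp_finite dim_eq_card[of T UNIV] by (auto simp: dim_UNIV)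
  then obtain e where e: "bij_betw e {1..DIM('e)} T"
    using bij_betw_from_nat_into_finite ex_bij_betw_nat_finite_1 by metis
  have mem: "e i \<in> T" if "i \<in> {1..DIM('e)}" for i
    using e that bij_betwE by blast
  have neq: "e i \<noteq> e j" if "i \<in> {1..DIM('e)}" "j \<in> {1..DIM('e)}" "i \<noteq> j" for i j
    using e that by (meson bij_betw_def inj_on_contraD)
  have "normalized_basis (\<lambda>x. B x x) e"
    unfolding normalized_basis_def family_basis_def polar_form_bilinear[OF B]
    using T mem neq e by (auto simp: bij_betw_def)
  then show ?thesis
    by blast
qed

section \<open>Products in algebras with a Clifford map\<close>

text \<open>\<open>x j\<close> moves right past the smaller indices, changing sign each time, until
  it meets its own index and contracts to a scalar, or finds its place in the order. Increasing
  lists stand for index sets so that the induction can follow the head.\<close>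

lemma sorted_prod_step:
  fixes x :: "'i::linorder \<Rightarrow> 'b::real_vector"
  assumes alg: "unital_algebra mul u"
    and sq: "\<And>j. j \<in> I \<Longrightarrow> \<exists>r. mul (x j) (x j) = r *\<^sub>R u"
    and anti: "\<And>j k. j \<in> I \<Longrightarrow> k \<in> I \<Longrightarrow> j \<noteq> k \<Longrightarrow> mul (x j) (x k) = - mul (x k) (x j)"
  assumes "sorted_wrt (<) l" "set l \<subseteq> I" "j \<in> I"
  shows "\<exists>r l'. mul (x j) (foldr mul (map x l) u) = r *\<^sub>R foldr mul (map x l') u \<and>
    sorted_wrt (<) l' \<and> set l' \<subseteq> insert j (set l)"
  using assms(4,5)
proof (induction l)
  case Nil
  show ?case
    by (intro exI[of _ 1] exI[of _ "[j]"]) auto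
next
  case (Cons k l)
  have assoc: "mul (mul a b) c = mul a (mul b c)" for a b c
    using alg by (simp add: unital_algebra_def)
  have bil: "bilinear mul"
    using alg by (simp add: unital_algebra_def)
  let ?F = "foldr mul (map x l) u"
  consider "j < k" | "j = k" | "k < j"
    using linorder_less_linear[of j k] by blast
  then show ?case
  proof cases
    case 1
    then show ?thesis
      using Cons.prems by (intro exI[of _ 1] exI[of _ "j # k # l"]) auto
  next
    case 2
    then obtain r where "mul (x j) (x k) = r *\<^sub>R u"
      using sq \<open>j \<in> I\<close> by blast
    then have "mul (x j) (mul (x k) ?F) = r *\<^sub>R ?F"
      using alg by (simp add: bilinear_lmul[OF bil] unital_algebra_def flip: assoc)
    then show ?thesis
      using Cons.prems by (intro exI[of _ r] exI[of _ l]) auto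
  next
    case 3
    obtain r l' where l': "mul (x j) ?F = r *\<^sub>R foldr mul (map x l') u"
      "sorted_wrt (<) l'" "set l' \<subseteq> insert j (set l)"
      using Cons by auto
    have "mul (x j) (mul (x k) ?F) = mul (- mul (x k) (x j)) ?F"
      using anti[of j k] Cons.prems \<open>j \<in> I\<close> 3 by (simp flip: assoc)
    also have "\<dots> = - mul (x k) (mul (x j) ?F)"
      by (simp add: bilinear_lneg[OF bil] assoc)
    also have "\<dots> = (- r) *\<^sub>R foldr mul (map x (k # l')) u"
      by (simp add: l'(1) bilinear_rmul[OF bil])
    finally show ?thesis
      using 3 Cons.prems l' by (intro exI[of _ "- r"] exI[of _ "k # l'"]) fastforce
  qed
qed

text \<open>Orthogonality makes \<open>q\<close> additive on the pair, so the two cross terms in the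
  square of \<open>\<phi> (x + y)\<close> must cancel.\<close>

lemma square_linear_anticommute:
  fixes q :: "'e::real_vector \<Rightarrow> real"
  assumes "bilinear mul" "linear \<phi>" "\<And>x. mul (\<phi> x) (\<phi> x) = q x *\<^sub>R u" "polar_form q x y = 0"
  shows "mul (\<phi> x) (\<phi> y) = - mul (\<phi> y) (\<phi> x)"
proof -
  have "q (x + y) = q x + q y"
    using assms(4) by (simp add: polar_form_def)
  then have "mul (\<phi> (x + y)) (\<phi> (x + y)) = mul (\<phi> x) (\<phi> x) + mul (\<phi> y) (\<phi> y)"
    by (simp add: assms(3) scaleR_add_left)
  then show ?thesis
    by (simp add: linear_add[OF assms(2)] bilinear_ladd[OF assms(1)] bilinear_radd[OF assms(1)]
        eq_neg_iff_add_eq_0 add.commute)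
qed

text \<open>Linearity, first in \<open>p\<close> and then in \<open>v\<close>, reduces the claim to
  one basis vector times one ordered product, where \<open>sorted_prod_step\<close> applies. As
  \<open>P\<close> contains the unit, it then contains every product of vectors.\<close>

lemma span_ordered_prod_left_ideal:
  fixes q :: "'e::euclidean_space \<Rightarrow> real"
  assumes alg: "unital_algebra mul u" and \<phi>: "linear \<phi>" "\<And>x. mul (\<phi> x) (\<phi> x) = q x *\<^sub>R u"
    and e: "normalized_basis q e"
  defines "P \<equiv> span (ordered_prod mul u (\<phi> \<circ> e) ` Pow {1..DIM('e)})"
  assumes "p \<in> P"
  shows "mul (\<phi> v) p \<in> P"
proof -
  have bil: "bilinear mul"
    using alg by (simp add: unital_algebra_def)
  let ?I = "{1..DIM('e)}"
  have anti: "mul ((\<phi> \<circ> e) j) ((\<phi> \<circ> e) k) = - mul ((\<phi> \<circ> e) k) ((\<phi> \<circ> e) j)"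
    if "j \<in> ?I" "k \<in> ?I" "j \<noteq> k" for j k
    unfolding comp_apply
    by (rule square_linear_anticommute[OF bil \<phi>]) (use that e in \<open>simp add: normalized_basis_def\<close>)
  have sq: "\<exists>r. mul ((\<phi> \<circ> e) j) ((\<phi> \<circ> e) j) = r *\<^sub>R u" for j
    using \<phi>(2) by auto
  have gen: "mul (\<phi> (e j)) (ordered_prod mul u (\<phi> \<circ> e) J) \<in> P" if J: "j \<in> ?I" "J \<subseteq> ?I" for j J
  proof -
    have "finite J"
      using J finite_subset by blast
    then obtain r l where l: "mul (\<phi> (e j)) (ordered_prod mul u (\<phi> \<circ> e) J) =
        r *\<^sub>R foldr mul (map (\<phi> \<circ> e) l) u" "sorted_wrt (<) l" "set l \<subseteq> insert j J"
      using sorted_prod_step[where x = "\<phi> \<circ> e" and I = ?I and l = "sorted_list_of_set J" and j = j,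
          OF alg sq anti] J
      by (auto simp: ordered_prod_def)
    \<comment> \<open>A strictly sorted list is determined by its set, so the result is again a
      multiple of an ordered product.\<close>
    have "sorted_list_of_set (set l) = l"
      using l(2) sorted_list_of_set.idem_if_sorted_distinct strict_sorted_iff by blast
    then have "foldr mul (map (\<phi> \<circ> e) l) u = ordered_prod mul u (\<phi> \<circ> e) (set l)"
      by (simp add: ordered_prod_def)
    moreover have "set l \<in> Pow ?I"
      using l(3) J by auto
    ultimately show ?thesis
      unfolding l(1) P_def by (simp add: span_base span_scale)
  qed
  have step': "mul (\<phi> (e j)) p \<in> P" if "j \<in> ?I" "p \<in> P" for j p
    using that(2) unfolding P_def
  proof (induction rule: span_induct_alt)
    case base
    then show ?case
      by (simp add: bilinear_rzero[OF bil] span_zero)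
  next
    case (step c x y)
    then show ?case
      using gen[OF \<open>j \<in> ?I\<close>] unfolding bilinear_radd[OF bil] bilinear_rmul[OF bil] P_def
      by (blast intro: span_add span_scale)
  qed
  have "v \<in> span (e ` ?I)"
    using e by (simp add: normalized_basis_def family_basis_def)
  then show ?thesis
  proof (induction rule: span_induct_alt)
    case base
    then show ?case
      by (simp add: linear_0[OF \<phi>(1)] bilinear_lzero[OF bil] P_def span_zero)
  next
    case (step c x y)
    then show ?case
      using step' \<open>p \<in> P\<close>
      unfolding linear_add[OF \<phi>(1)] linear_cmul[OF \<phi>(1)] bilinear_ladd[OF bil] bilinear_lmul[OF bil] P_def
      by (blast intro: span_add span_scale)
  qed
qed

text \<open>Spanning takes at least \<open>DIM('v)\<close> distinct vectors, and there are only that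
  many indices; hence no vector is repeated and none is redundant.\<close>

lemma family_basis_spanning:
  fixes b :: "'i \<Rightarrow> 'v::euclidean_space"
  assumes "finite I" "card I = DIM('v)" "span (b ` I) = UNIV"
  shows "family_basis I b"
proof -
  have "DIM('v) \<le> card (b ` I)"
    using assms(1,3) dim_le_card[of UNIV "b ` I"] by (simp add: dim_UNIV)
  then have c: "card (b ` I) = card I"
    using assms card_image_le by (metis order_antisym)
  then have "independent (b ` I)"
    using assms by (intro card_le_dim_spanning[of _ UNIV]) (auto simp: dim_UNIV)
  then show ?thesis
    using c assms by (simp add: family_basis_def eq_card_imp_inj_on)
qed

section \<open>Twisted group algebras of elementary abelian 2-groups\<close>

text \<open>Vectors are functions on \<open>(Z/2)\<^sup>n\<close>, encoded as subsets with symmetric difference. In a Clifford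
  algebra with generators \<open>e\<^sub>i\<close>, \<open>twist c S T\<close> is the sign in \<open>e\<^sub>S e\<^sub>T = \<plusminus> e\<^sub>U\<close>, where \<open>U\<close> is the symmetric
  difference of \<open>S\<close> and \<open>T\<close>, provided that \<open>c i j\<close> is \<open>-1\<close> for \<open>i > j\<close>, \<open>1\<close> for \<open>i < j\<close> and \<open>e\<^sub>i\<^sup>2\<close> for
  \<open>i = j\<close>.\<close>

definition twist :: "('n \<Rightarrow> 'n \<Rightarrow> real) \<Rightarrow> 'n set \<Rightarrow> 'n set \<Rightarrow> real" where
  "twist c S T = (\<Prod>i\<in>S. \<Prod>j\<in>T. c i j)"

text \<open>A signed convolution: the coefficient at \<open>W\<close> collects the pairs
  \<open>S\<close>, \<open>T\<close> with symmetric difference \<open>W\<close>, and these are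
  exactly the pairs with \<open>T = sym_diff S W\<close>.\<close>

definition twisted_mult ::
  "('n::finite \<Rightarrow> 'n \<Rightarrow> real) \<Rightarrow> real ^ ('n set) \<Rightarrow> real ^ ('n set) \<Rightarrow> real ^ ('n set)" where
  "twisted_mult c x y = (\<chi> W. \<Sum>S\<in>UNIV. twist c S (sym_diff S W) * x $ S * y $ sym_diff S W)"

text \<open>Indices common to \<open>S\<close> and \<open>T\<close> contribute squares, hence 1.
  This is the source of the bimultiplicativity of \<open>twist\<close>.\<close>

lemma prod_sym_diff:
  fixes f :: "'n::finite \<Rightarrow> real"
  assumes "\<And>i. f i * f i = 1"
  shows "prod f (sym_diff S T) = prod f S * prod f T"
proof -
  have *: "prod f A = (\<Prod>i\<in>UNIV. if i \<in> A then f i else 1)" for A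
    by (simp add: prod.If_cases)
  show ?thesis
    unfolding * prod.distrib[symmetric] by (rule prod.cong) (auto simp: assms)
qed

lemma bilinear_twisted_mult: "bilinear (twisted_mult c)"
  unfolding bilinear_def twisted_mult_def
  by (auto intro!: linearI simp: vec_eq_iff algebra_simps sum.distrib sum_distrib_left)

context
  fixes c :: "'n::finite \<Rightarrow> 'n \<Rightarrow> real"
  assumes c: "\<And>i j. c i j * c i j = 1"
begin

lemma twist_sym_diff_right: "twist c R (sym_diff S T) = twist c R S * twist c R T"
  unfolding twist_def by (simp only: prod_sym_diff[OF c] prod.distrib)

lemma prod_sign_square: "(\<Prod>j\<in>T. c i j) * (\<Prod>j\<in>T. c i j) = 1"
  by (simp add: c flip: prod.distrib)

lemma twist_sym_diff_left: "twist c (sym_diff R S) T = twist c R T * twist c S T"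
  unfolding twist_def using prod_sym_diff[of "\<lambda>i. \<Prod>j\<in>T. c i j"] prod_sign_square by blast

lemma twist_square: "twist c S T * twist c S T = 1"
  unfolding twist_def by (simp only: prod_sign_square prod.neutral_const flip: prod.distrib[of _ _ S])

lemma twisted_mult_assoc:
  "twisted_mult c (twisted_mult c x y) z = twisted_mult c x (twisted_mult c y z)"
proof -
  let ?t = "twist c"
  \<comment> \<open>The cocycle identity, with the indices that \<open>x\<close>, \<open>y\<close>
    and \<open>z\<close> carry in the sum: \<open>R\<close>, \<open>sym_diff R S\<close> and
    \<open>sym_diff S W\<close>.\<close>
  have cocycle: "?t S (sym_diff S W) * ?t R (sym_diff R S)
      = ?t R (sym_diff R W) * ?t (sym_diff R S) (sym_diff S W)" for R S W
  proof -
    have "sym_diff R S = sym_diff (sym_diff R W) (sym_diff S W)"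
      by auto
    then have "?t R (sym_diff R S) = ?t R (sym_diff R W) * ?t R (sym_diff S W)"
      using twist_sym_diff_right by metis
    then show ?thesis
      by (simp add: twist_sym_diff_left)
  qed
  have "twisted_mult c (twisted_mult c x y) z $ W = twisted_mult c x (twisted_mult c y z) $ W" for W
  proof -
    have "twisted_mult c (twisted_mult c x y) z $ W = (\<Sum>S\<in>UNIV. \<Sum>R\<in>UNIV.
        ?t S (sym_diff S W) * ?t R (sym_diff R S) * x $ R * y $ sym_diff R S * z $ sym_diff S W)"
      by (simp add: twisted_mult_def sum_distrib_left sum_distrib_right mult_ac)
    also have "\<dots> = (\<Sum>R\<in>UNIV. \<Sum>S\<in>UNIV.
        ?t S (sym_diff S W) * ?t R (sym_diff R S) * x $ R * y $ sym_diff R S * z $ sym_diff S W)"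
      by (rule sum.swap)
    \<comment> \<open>All indices are rewritten through \<open>R\<close>, \<open>W\<close> and
      \<open>sym_diff R S\<close>, since the last is to become the summation variable
      \<open>Q\<close>.\<close>
    also have "\<dots> = (\<Sum>R\<in>UNIV. \<Sum>S\<in>UNIV. ?t R (sym_diff R W) * x $ R *
        (?t (sym_diff R S) (sym_diff (sym_diff R S) (sym_diff R W)) * y $ sym_diff R S *
          z $ sym_diff (sym_diff R S) (sym_diff R W)))"
    proof (intro sum.cong refl)
      fix R S
      have "sym_diff (sym_diff R S) (sym_diff R W) = sym_diff S W"
        by auto
      then show "?t S (sym_diff S W) * ?t R (sym_diff R S) * x $ R * y $ sym_diff R S * z $ sym_diff S W
        = ?t R (sym_diff R W) * x $ R *
        (?t (sym_diff R S) (sym_diff (sym_diff R S) (sym_diff R W)) * y $ sym_diff R S *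
          z $ sym_diff (sym_diff R S) (sym_diff R W))"
        unfolding cocycle by (simp only: mult_ac)
    qed
    also have "\<dots> = (\<Sum>R\<in>UNIV. \<Sum>Q\<in>UNIV. ?t R (sym_diff R W) * x $ R *
        (?t Q (sym_diff Q (sym_diff R W)) * y $ Q * z $ sym_diff Q (sym_diff R W)))"
    proof (rule sum.cong[OF refl])
      fix R :: "'n set"
      have "bij_betw (sym_diff R) UNIV UNIV"
        by (rule bij_betw_byWitness[where f' = "sym_diff R"]) auto
      from sum.reindex_bij_betw[OF this, of "\<lambda>Q. ?t R (sym_diff R W) * x $ R *
        (?t Q (sym_diff Q (sym_diff R W)) * y $ Q * z $ sym_diff Q (sym_diff R W))"]
      show "(\<Sum>S\<in>UNIV. ?t R (sym_diff R W) * x $ R *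
        (?t (sym_diff R S) (sym_diff (sym_diff R S) (sym_diff R W)) * y $ sym_diff R S *
          z $ sym_diff (sym_diff R S) (sym_diff R W))) = (\<Sum>Q\<in>UNIV. ?t R (sym_diff R W) * x $ R *
        (?t Q (sym_diff Q (sym_diff R W)) * y $ Q * z $ sym_diff Q (sym_diff R W)))" .
    qed
    also have "\<dots> = twisted_mult c x (twisted_mult c y z) $ W"
      by (simp add: twisted_mult_def sum_distrib_left)
    finally show ?thesis .
  qed
  then show ?thesis
    by (simp add: vec_eq_iff)
qed

lemma twisted_mult_axis:
  "twisted_mult c (axis S 1) (axis T 1) = twist c S T *\<^sub>R axis (sym_diff S T) 1"
proof -
  have iff: "sym_diff S W = T \<longleftrightarrow> W = sym_diff S T" for W
    by auto
  have "(\<Sum>R\<in>UNIV. twist c R (sym_diff R W) * axis S 1 $ R * axis T 1 $ sym_diff R W)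
    = (\<Sum>R\<in>UNIV. if R = S then twist c S (sym_diff S W) * axis T 1 $ sym_diff S W else 0)" for W
    by (rule sum.cong) (auto simp: axis_def)
  then have "twisted_mult c (axis S 1) (axis T 1) $ W
    = twist c S (sym_diff S W) * axis T 1 $ sym_diff S W" for W
    by (simp add: twisted_mult_def)
  moreover have "twist c S (sym_diff S W) * axis T 1 $ sym_diff S W
    = twist c S T * axis (sym_diff S T) 1 $ W" for W
    using iff[of W] by (cases "sym_diff S W = T") (simp_all add: axis_def)
  ultimately show ?thesis
    by (simp add: vec_eq_iff)
qed

lemma unital_algebra_twisted_mult: "unital_algebra (twisted_mult c) (axis {} 1)"
proof -
  have "(\<Sum>R\<in>UNIV. twist c R (sym_diff R W) * axis {} 1 $ R * x $ sym_diff R W)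
    = (\<Sum>R\<in>UNIV. if R = ({} :: 'n set) then x $ W else 0)" for W x
    by (rule sum.cong) (auto simp: axis_def twist_def)
  moreover have "(\<Sum>R\<in>UNIV. twist c R (sym_diff R W) * x $ R * axis {} 1 $ sym_diff R W)
    = (\<Sum>R\<in>UNIV. if R = W then x $ W else 0)" for W x
  proof (rule sum.cong)
    fix R
    have "axis {} (1 :: real) $ sym_diff R W = (if R = W then 1 else 0)"
      by (auto simp: axis_def)
    then show "twist c R (sym_diff R W) * x $ R * axis {} 1 $ sym_diff R W = (if R = W then x $ W else 0)"
      by (simp add: twist_def)
  qed simp
  ultimately have "twisted_mult c (axis {} 1) x = x" "twisted_mult c x (axis {} 1) = x" for x
    by (simp_all add: twisted_mult_def vec_eq_iff)
  then show ?thesis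
    by (simp add: unital_algebra_def bilinear_twisted_mult twisted_mult_assoc)
qed

text \<open>Multiplying the unit by one generator at a time reaches every basis vector up to a sign,
  which \<open>twist_square\<close> removes.\<close>

lemma axis_mem_left_ideal:
  assumes P: "subspace P" "axis {} 1 \<in> P" "\<And>i p. p \<in> P \<Longrightarrow> twisted_mult c (axis {i} 1) p \<in> P"
  shows "axis S 1 \<in> P"
  using finite[of S]
proof (induction S)
  case empty
  then show ?case
    by (rule P(2))
next
  case (insert i S)
  have "sym_diff {i} S = insert i S"
    using insert.hyps by auto
  then have "twist c {i} S *\<^sub>R twisted_mult c (axis {i} 1) (axis S 1) = axis (insert i S) 1"
    by (simp add: twisted_mult_axis twist_square)
  then show ?case
    using P insert.IH subspace_mul by metis
qed

end

text \<open>The double sum is added to its copy with \<open>i\<close> and \<open>j\<close>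
  exchanged. Off the diagonal \<open>c\<close> changes sign while \<open>sym_diff {i} {j}\<close>
  does not, so only the diagonal remains, counted twice.\<close>

lemma twisted_mult_square:
  fixes c :: "'n::finite \<Rightarrow> 'n \<Rightarrow> real"
  assumes c: "\<And>i j. c i j * c i j = 1" "\<And>i j. i \<noteq> j \<Longrightarrow> c j i = - c i j"
  defines "\<psi> \<equiv> \<lambda>a :: real ^ 'n. \<Sum>i\<in>UNIV. a $ i *\<^sub>R (axis {i} 1 :: real ^ ('n set))"
  shows "twisted_mult c (\<psi> a) (\<psi> a) = (\<Sum>i\<in>UNIV. c i i * (a $ i)\<^sup>2) *\<^sub>R axis {} 1"
proof -
  let ?t = "\<lambda>i j. (a $ i * a $ j * c i j) *\<^sub>R axis (sym_diff {i} {j}) 1 :: real ^ ('n set)"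
  let ?X = "twisted_mult c (\<psi> a) (\<psi> a)"
  note bil = bilinear_twisted_mult[of c]
  have X: "?X = (\<Sum>i\<in>UNIV. \<Sum>j\<in>UNIV. ?t i j)"
    unfolding \<psi>_def bilinear_sum[OF bil] sum.cartesian_product
    by (rule sum.cong) (auto simp: bilinear_lmul[OF bil] bilinear_rmul[OF bil] twisted_mult_axis[OF c(1)]
        twist_def mult_ac)
  then have X': "?X = (\<Sum>i\<in>UNIV. \<Sum>j\<in>UNIV. ?t j i)"
    by (metis (no_types) sum.swap[of ?t UNIV UNIV])
  have "?X + ?X = (\<Sum>i\<in>UNIV. \<Sum>j\<in>UNIV. ?t i j + ?t j i)"
    by (subst (1) X, subst X') (simp add: sum.distrib)
  also have "\<dots> = (\<Sum>i\<in>UNIV. \<Sum>j\<in>UNIV. if j = i then (2 * (c i i * (a $ i)\<^sup>2)) *\<^sub>R axis {} 1 else 0)"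
  proof (intro sum.cong refl)
    fix i j
    show "?t i j + ?t j i = (if j = i then (2 * (c i i * (a $ i)\<^sup>2)) *\<^sub>R axis {} 1 else 0)"
      using c(2)[of i j]
      by (cases "j = i") (auto simp: power2_eq_square mult_ac Un_commute simp flip: scaleR_add_left)
  qed
  also have "\<dots> = 2 *\<^sub>R (\<Sum>i\<in>UNIV. c i i * (a $ i)\<^sup>2) *\<^sub>R axis {} 1"
    by (simp add: scaleR_sum_left sum_distrib_left scaleR_sum_right)
  finally have "2 *\<^sub>R ?X = 2 *\<^sub>R (\<Sum>i\<in>UNIV. c i i * (a $ i)\<^sup>2) *\<^sub>R axis {} 1"
    by (simp only: scaleR_2)
  then show ?thesis
    by (simp only: scaleR_cancel_left) simp
qed

section \<open>Existence of Clifford algebras\<close>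

text \<open>One normalized basis serves to build the algebra. The definition asks for a basis of
  products from every normalized basis; this follows from spanning and a dimension count, without
  any change of basis.\<close>

lemma has_clifford_algebra_bilinear:
  fixes B :: "real ^ 'n::finite \<Rightarrow> real ^ 'n \<Rightarrow> real"
  assumes B: "bilinear B" "\<And>x y. B x y = B y x"
    and nondeg: "\<And>x. (\<And>y. B x y = 0) \<Longrightarrow> x = 0"
  shows "has_clifford_algebra (\<lambda>x. B x x)"
proof -
  let ?q = "\<lambda>x. B x x"
  let ?I = "{1..DIM(real ^ 'n)}"
  obtain e where e: "normalized_basis ?q e"
    using normalized_basis_exists[OF assms] by blast
  have orth: "B (e i) (e j) = 0" if "i \<in> ?I" "j \<in> ?I" "i \<noteq> j" for i j
    using e that unfolding normalized_basis_def polar_form_bilinear[OF B] by blast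
  have sgn: "B (e i) (e i) \<in> {1, -1}" if "i \<in> ?I" for i
    using e that unfolding normalized_basis_def polar_form_bilinear[OF B] by blast
  have basis: "inj_on e ?I" "independent (e ` ?I)" "span (e ` ?I) = UNIV"
    using e by (auto simp: normalized_basis_def family_basis_def)
  have "card ?I = CARD('n)"
    by simp
  \<comment> \<open>The type \<open>'n\<close> carries no order; the numbering \<open>h\<close>
    supplies the one that fixes the signs.\<close>
  then obtain h :: "'n \<Rightarrow> nat" where h: "bij_betw h UNIV ?I"
    using bij_betw_iff_card[of "UNIV :: 'n set" ?I] by auto
  have hI: "h i \<in> ?I" for i
    using h bij_betwE by blast
  have h_eq: "h i = h j \<longleftrightarrow> i = j" for i j
    using h by (auto simp: bij_betw_def inj_on_def)
  \<comment> \<open>The diagonal prescribes the squares of the generators; off it, a product in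
    decreasing order costs a sign.\<close>
  define c where "c i j = (if i = j then B (e (h i)) (e (h i)) else if h j < h i then - 1 else 1)" for i j
  have c: "c i j * c i j = 1" for i j
    using sgn[OF hI[of i]] by (auto simp: c_def)
  have c_anti: "c j i = - c i j" if "i \<noteq> j" for i j
    using that h_eq[of i j] by (auto simp: c_def)
  define b where "b = (\<lambda>i. e (h i))"
  have b_range: "range b = e ` ?I"
    using h by (simp add: b_def bij_betw_def flip: image_image[of e h])
  have "inj b"
    using comp_inj_on[of h UNIV e] h basis(1) by (simp add: b_def bij_betw_def comp_def)
  \<comment> \<open>\<open>L v $ i\<close> is the coordinate of \<open>v\<close> at
    \<open>b i\<close>.\<close>
  obtain L :: "real ^ 'n \<Rightarrow> real ^ 'n" where L: "linear L" "\<And>i. L (b i) = axis i 1"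
  proof -
    obtain L :: "real ^ 'n \<Rightarrow> real ^ 'n" where "linear L" "\<forall>x\<in>range b. L x = axis (inv b x) 1"
      using linear_independent_extend[of "range b" "\<lambda>x. axis (inv b x) 1"] basis(2) b_range by auto
    then show ?thesis
      using that \<open>inj b\<close> by simp
  qed
  have expand: "v = (\<Sum>i\<in>UNIV. L v $ i *\<^sub>R b i)" for v
  proof (rule linear_eq_on_span[of "\<lambda>v. v" "\<lambda>v. \<Sum>i\<in>UNIV. L v $ i *\<^sub>R b i" "range b"])
    show "linear (\<lambda>v. \<Sum>i\<in>UNIV. L v $ i *\<^sub>R b i)"
      by (rule linearI) (simp_all add: linear_add[OF L(1)] linear_cmul[OF L(1)] scaleR_add_left
          sum.distrib scaleR_sum_right)
    show "x = (\<Sum>i\<in>UNIV. L x $ i *\<^sub>R b i)" if "x \<in> range b" for x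
    proof -
      from that obtain k where k: "x = b k"
        by blast
      have "(\<Sum>i\<in>UNIV. L x $ i *\<^sub>R b i) = (\<Sum>i\<in>UNIV. if i = k then b i else 0)"
        by (rule sum.cong) (auto simp: k L(2) axis_def)
        then show ?thesis
        by (simp add: k)
    qed
    show "v \<in> span (range b)"
      by (simp only: b_range basis(3) UNIV_I)
  qed (rule linear_id[unfolded id_def])
  define \<phi> where "\<phi> v = (\<Sum>i\<in>UNIV. L v $ i *\<^sub>R (axis {i} 1 :: real ^ ('n set)))" for v
  have \<phi>_lin: "linear \<phi>"
    unfolding \<phi>_def by (rule linearI) (simp_all add: linear_add[OF L(1)] linear_cmul[OF L(1)]
        scaleR_add_left sum.distrib scaleR_sum_right)
  have \<phi>_b: "\<phi> (b k) = axis {k} 1" for k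
  proof -
    have "\<phi> (b k) = (\<Sum>i\<in>UNIV. if i = k then axis {i} 1 else 0)"
      unfolding \<phi>_def L(2) by (rule sum.cong) (auto simp: axis_def)
    then show ?thesis
      by simp
  qed
  have q: "B v v = (\<Sum>i\<in>UNIV. c i i * (L v $ i)\<^sup>2)" for v
  proof -
    have "B v v = B (\<Sum>i\<in>UNIV. L v $ i *\<^sub>R b i) (\<Sum>j\<in>UNIV. L v $ j *\<^sub>R b j)"
      using expand[of v] by simp
    also have "\<dots> = (\<Sum>i\<in>UNIV. \<Sum>j\<in>UNIV. B (L v $ i *\<^sub>R b i) (L v $ j *\<^sub>R b j))"
      by (simp only: bilinear_sum[OF B(1)] sum.cartesian_product)
    also have "\<dots> = (\<Sum>i\<in>UNIV. \<Sum>j\<in>UNIV. if j = i then c i i * (L v $ i)\<^sup>2 else 0)"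
      using orth[OF hI hI] h_eq
      by (intro sum.cong refl) (auto simp: bilinear_lmul[OF B(1)] bilinear_rmul[OF B(1)] b_def c_def
          power2_eq_square)
    finally show ?thesis
      by simp
  qed
  have \<phi>_sq: "twisted_mult c (\<phi> v) (\<phi> v) = B v v *\<^sub>R axis {} 1" for v
    unfolding \<phi>_def q by (rule twisted_mult_square[OF c c_anti])
  note alg = unital_algebra_twisted_mult[OF c]
  have "family_basis (Pow ?I) (ordered_prod (twisted_mult c) (axis {} 1) (\<phi> \<circ> e'))"
    if e': "normalized_basis ?q e'" for e'
  proof (rule family_basis_spanning)
    let ?P = "span (ordered_prod (twisted_mult c) (axis {} 1) (\<phi> \<circ> e') ` Pow ?I)"
    have "card (UNIV :: 'n set set) = 2 ^ CARD('n)"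
      using card_Pow[of "UNIV :: 'n set"] by simp
    then show "card (Pow ?I) = DIM(real ^ ('n set))"
      by (simp add: card_Pow)
    have "ordered_prod (twisted_mult c) (axis {} 1) (\<phi> \<circ> e') {} = axis {} 1"
      by (simp add: ordered_prod_def)
    then have unit: "axis {} 1 \<in> ?P"
      by (metis Pow_bottom image_eqI span_base)
    \<comment> \<open>The generator \<open>axis {i} 1\<close> is \<open>\<phi> (b i)\<close>, the
      image of a vector, so left multiplication by it preserves \<open>?P\<close> although
      \<open>?P\<close> is built from \<open>e'\<close>.\<close>
    have axis: "axis S 1 \<in> ?P" for S
    proof (rule axis_mem_left_ideal[OF c subspace_span unit])
      fix i p assume "p \<in> ?P"
      then show "twisted_mult c (axis {i} 1) p \<in> ?P"
        using span_ordered_prod_left_ideal[OF alg \<phi>_lin \<phi>_sq e', of p "b i"] by (simp add: \<phi>_b)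
    qed
    have "x \<in> ?P" for x
    proof -
      have "x = (\<Sum>S\<in>UNIV. x $ S *\<^sub>R axis S 1)"
        by (simp add: basis_expansion flip: scalar_mult_eq_scaleR)
      also have "\<dots> \<in> ?P"
        by (intro span_sum span_scale axis)
      finally show ?thesis .
    qed
    then show "?P = UNIV"
      by blast
  qed simp
  then have "clifford_algebra ?q (twisted_mult c) (axis {} 1) \<phi>"
    unfolding clifford_algebra_def by (intro conjI allI impI exI[of _ e] alg \<phi>_lin \<phi>_sq e)
  then show ?thesis
    unfolding has_clifford_algebra_def by (intro exI)
qed

text \<open>By symmetry, a vector in the radical of the bilinear form is mapped to a vector
  orthogonal to everything, so it lies in the kernel of the Hessian.\<close>

lemma has_clifford_algebra_hessian_form:
  assumes "C2_on S h" "open S" "a \<in> S" and "\<And>v. hessian h a *v v = 0 \<Longrightarrow> v = 0"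
  shows "has_clifford_algebra (hessian_form h a)"
proof -
  have "v = 0" if "\<And>w. hessian_bilinear h a v w = 0" for v
  proof (rule assms(4))
    have "w \<bullet> (hessian h a *v v) = 0" for w
      using that[of w] hessian_bilinear_commute[OF assms(1-3), of v w]
      by (simp add: hessian_bilinear_def)
    then show "hessian h a *v v = 0"
      using inner_eq_zero_iff by blast
  qed
  then have "has_clifford_algebra (\<lambda>v. hessian_bilinear h a v v)"
    by (rule has_clifford_algebra_bilinear[OF bilinear_hessian_bilinear
          hessian_bilinear_commute[OF assms(1-3)]])
  then show ?thesis
    by (simp add: hessian_bilinear_diag)
qed

section \<open>The Legendre transform\<close>

text \<open>Since \<open>f\<close> has gradient \<open>y\<close> at the inverse image of
  \<open>y\<close>, the chain rule term \<open>D (G v)\<close> cancels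
  \<open>G v \<bullet> y\<close> from the product rule.\<close>

lemma legendre_has_derivative:
  assumes h: "(f has_derivative D) (at (the_inv_into S (grad f) y))"
    and g: "(the_inv_into S (grad f) has_derivative G) (at y)"
    and y: "grad f (the_inv_into S (grad f) y) = y"
  shows "(legendre S f has_derivative (\<lambda>v. - (the_inv_into S (grad f) y \<bullet> v))) (at y)"
proof -
  let ?g = "the_inv_into S (grad f)"
  have "((\<lambda>y. f (?g y) - ?g y \<bullet> y) has_derivative (\<lambda>v. D (G v) - (?g y \<bullet> v + G v \<bullet> y))) (at y)"
    by (intro has_derivative_diff has_derivative_inner g has_derivative_ident
        has_derivative_compose[where g = f, OF g h])
  moreover have "D (G v) = G v \<bullet> y" for v
    using has_derivative_grad[OF h] y by (simp add: inner_commute)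
  ultimately show ?thesis
    unfolding legendre_def Let_def by simp
qed

lemma partial_deriv_legendre:
  assumes f: "C1_on S f" and diffeo: "C1_diffeomorphism S T (grad f)" and "y \<in> T"
  shows "(legendre S f has_derivative (\<lambda>v. - (the_inv_into S (grad f) y \<bullet> v))) (at y)"
    and "partial_deriv l (legendre S f) y = - (the_inv_into S (grad f) y $ l)"
proof -
  have bij: "bij_betw (grad f) S T"
    using diffeo by (simp add: C1_diffeomorphism_def)
  have "the_inv_into S (grad f) y \<in> S"
    using bij \<open>y \<in> T\<close> bij_betwE bij_betw_the_inv_into by blast
  then obtain D where "(f has_derivative D) (at (the_inv_into S (grad f) y))"
    using f C1_on_def by metis
  moreover obtain G where "(the_inv_into S (grad f) has_derivative G) (at y)"
    using diffeo \<open>y \<in> T\<close> unfolding C1_on_def C1_diffeomorphism_def by metis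
  moreover have "grad f (the_inv_into S (grad f) y) = y"
    using bij \<open>y \<in> T\<close> by (rule f_the_inv_into_f_bij_betw)
  ultimately show *: "(legendre S f has_derivative (\<lambda>v. - (the_inv_into S (grad f) y \<bullet> v))) (at y)"
    by (rule legendre_has_derivative)
  show "partial_deriv l (legendre S f) y = - (the_inv_into S (grad f) y $ l)"
    using partial_deriv_eq[OF *] by (simp add: inner_axis)
qed

text \<open>One order of smoothness is gained: the partial derivatives are the negated coordinates
  of the inverse gradient map, which is itself \<open>C1_on\<close>.\<close>

lemma C2_on_legendre:
  assumes f: "C1_on S f" and diffeo: "C1_diffeomorphism S T (grad f)" and "open T"
  shows "C2_on T (legendre S f)"
proof -
  let ?g = "the_inv_into S (grad f)"
  have g: "C1_on T ?g"
    using diffeo by (simp add: C1_diffeomorphism_def)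
  then have "continuous_on T ?g"
    by (rule C1_on_continuous)
  then have "continuous_on T (\<lambda>y. - blinfun_inner_right (?g y))"
    by (intro continuous_intros)
  moreover have "(legendre S f has_derivative blinfun_apply (- blinfun_inner_right (?g y))) (at y)"
    if "y \<in> T" for y
  proof -
    have "blinfun_apply (- blinfun_inner_right (?g y)) = (\<lambda>v. - (?g y \<bullet> v))"
      by (simp add: fun_eq_iff blinfun.minus_left)
    then show ?thesis
      using partial_deriv_legendre(1)[OF f diffeo that] by (simp only:)
  qed
  ultimately have "C1_on T (legendre S f)"
    unfolding C1_on_def by (intro exI[of _ "\<lambda>y. - blinfun_inner_right (?g y)"] conjI ballI)
  moreover have "C1_on T (partial_deriv l (legendre S f))" for l
  proof (rule C1_on_cong[OF _ \<open>open T\<close>])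
    show "C1_on T (\<lambda>y. - (?g y $ l))"
      by (rule bounded_linear_C1_on[OF g bounded_linear_minus[OF bounded_linear_vec_nth]])
  qed (simp only: partial_deriv_legendre(2)[OF f diffeo])
  ultimately show ?thesis
    by (simp add: C2_on_def)
qed

text \<open>The row index of \<open>hessian\<close> is the direction of the outer derivative, so its
  transpose is the Jacobian of the gradient, here that of minus the inverse gradient map.\<close>

lemma hessian_legendre_mult:
  assumes f: "C1_on S f" and diffeo: "C1_diffeomorphism S T (grad f)" and "open T" "y \<in> T"
    and G: "(the_inv_into S (grad f) has_derivative G) (at y)"
  shows "transpose (hessian (legendre S f) y) *v v = - G v"
proof -
  let ?g = "the_inv_into S (grad f)"
  have "hessian (legendre S f) y $ j $ l = - (G (axis j 1) $ l)" for j l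
  proof -
    have "((\<lambda>y. - (?g y $ l)) has_derivative (\<lambda>v. - (G v $ l))) (at y)"
      by (intro derivative_intros bounded_linear.has_derivative[OF bounded_linear_vec_nth] G)
    then have "(partial_deriv l (legendre S f) has_derivative (\<lambda>v. - (G v $ l))) (at y)"
      using \<open>open T\<close> \<open>y \<in> T\<close>
      by (rule has_derivative_transform_within_open) (simp add: partial_deriv_legendre(2)[OF f diffeo])
    then show ?thesis
      by (simp add: hessian_def partial_deriv_eq)
  qed
  then have "transpose (hessian (legendre S f) y) = - matrix G"
    by (simp add: vec_eq_iff transpose_def matrix_def)
  moreover have "matrix G *v v = G v"
    using matrix_works[of G v] has_derivative_linear[OF G] by (simp add: linear_matrix_vector_mul_eq)
  ultimately show ?thesis
    by (simp add: matrix_vector_mult_def vec_eq_iff sum_negf)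
qed

theorem proposition3:
  fixes \<Omega> \<Omega>\<^sub>0 \<Omega>\<^sub>0' :: "(real ^ 'n::finite) set" and f :: "real ^ 'n \<Rightarrow> real"
  assumes "open \<Omega>" and "C2_on \<Omega> f"
    and "\<Omega>\<^sub>0 \<subseteq> \<Omega>"
    and "open \<Omega>\<^sub>0" and "\<Omega>\<^sub>0 \<noteq> {}"
    and "open \<Omega>\<^sub>0'" and "\<Omega>\<^sub>0' \<noteq> {}"
    and "C1_diffeomorphism \<Omega>\<^sub>0 \<Omega>\<^sub>0' (grad f)"
    and "\<And>a. a \<in> \<Omega>\<^sub>0 \<Longrightarrow> invertible (hessian f a)"
  shows "C2_on \<Omega>\<^sub>0' (legendre \<Omega>\<^sub>0 f) \<and>
    (\<forall>a\<in>\<Omega>\<^sub>0. has_clifford_algebra (hessian_form f a)) \<and>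
    (\<forall>b\<in>\<Omega>\<^sub>0'. has_clifford_algebra (hessian_form (legendre \<Omega>\<^sub>0 f) b))"
proof (intro conjI ballI)
  have f: "C1_on \<Omega>\<^sub>0 f"
    using assms(2,3) C1_on_subset by (auto simp: C2_on_def)
  note diffeo = assms(8)
  \<comment> \<open>This conjunct ensures that the Hessian of the transform consists of genuine
    derivatives and not of arbitrary values of \<open>deriv\<close>.\<close>
  show C2: "C2_on \<Omega>\<^sub>0' (legendre \<Omega>\<^sub>0 f)"
    by (rule C2_on_legendre[OF f diffeo assms(6)])
  show "has_clifford_algebra (hessian_form f a)" if "a \<in> \<Omega>\<^sub>0" for a
  proof (rule has_clifford_algebra_hessian_form[OF assms(2,1)])
    show "a \<in> \<Omega>"
      using that assms(3) by blast
    show "v = 0" if "hessian f a *v v = 0" for v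
      using assms(9)[OF \<open>a \<in> \<Omega>\<^sub>0\<close>] that matrix_left_invertible_ker[of "hessian f a"]
      unfolding invertible_def by blast
  qed
  show "has_clifford_algebra (hessian_form (legendre \<Omega>\<^sub>0 f) b)" if b: "b \<in> \<Omega>\<^sub>0'" for b
  proof (rule has_clifford_algebra_hessian_form[OF C2 assms(6) b])
    let ?g = "the_inv_into \<Omega>\<^sub>0 (grad f)"
    let ?H = "hessian (legendre \<Omega>\<^sub>0 f) b"
    have bij: "bij_betw (grad f) \<Omega>\<^sub>0 \<Omega>\<^sub>0'"
      using diffeo by (simp add: C1_diffeomorphism_def)
    then have "?g b \<in> \<Omega>\<^sub>0"
      using b bij_betwE bij_betw_the_inv_into by blast
    then obtain F G where F: "(grad f has_derivative F) (at (?g b))" and G: "(?g has_derivative G) (at b)"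
      using diffeo b unfolding C1_diffeomorphism_def C1_on_def by metis
    have "((\<lambda>y. grad f (?g y)) has_derivative (\<lambda>v. F (G v))) (at b)"
      by (rule has_derivative_compose[OF G F])
    \<comment> \<open>The composite is the identity on an open set around \<open>b\<close>, so
      \<open>F\<close> is a left inverse of \<open>G\<close>; thus \<open>G\<close>, and with it the
      Hessian \<open>- G\<close>, has trivial kernel.\<close>
    then have "((\<lambda>y. y) has_derivative (\<lambda>v. F (G v))) (at b)"
      using assms(6) b
      by (rule has_derivative_transform_within_open) (simp add: f_the_inv_into_f_bij_betw[OF bij])
    then have FG: "F (G v) = v" for v
      using has_derivative_unique[OF has_derivative_ident] by metis
    have "?H *v v = - G v" for v
      using transpose_hessian[OF C2 assms(6) b] hessian_legendre_mult[OF f diffeo assms(6) b G] by metis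
    then show "v = 0" if "?H *v v = 0" for v
      using that FG[of v] linear_0[OF has_derivative_linear[OF F]] by simp
  qed
qed

end
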